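(* Let $\{G_m\}_{m\in\mathbb Z}$ and $\{H_m\}_{m\in\mathbb Z}$ be two generalized Fibonacci sequences, let $n,m,r$ be integers and let $k$ be a non-negative integer. The following identities hold. (i) If $G_0\neq 0$, then $$\sum_{j=0}^k\sum_{s=0}^j(-1)^{nj+s}\binom kj\binom js\frac{G_{n+r}^{\,j-s}G_n^{\,s}}{G_0^{\,j}}H_{m+rk+(n-r)j+rs}=\left(\frac{G_r}{G_0}\right)^kH_m .$$ (ii) If $G_{n+r}\neq 0$, then $$\sum_{j=0}^k\sum_{s=0}^j(-1)^{n(j+s)+s}\binom kj\binom js\frac{G_0^{\,j-s}G_n^{\,s}}{G_{n+r}^{\,j}}H_{m+nk+(r-n)j+ns}=(-1)^{nk}\left(\frac{G_r}{G_{n+r}}\right)^kH_m .$$ (iii) If $G_n\neq 0$, then $$\sum_{j=0}^k\sum_{s=0}^j(-1)^{n(j+s)+j}\binom kj\binom js\frac{G_0^{\,j-s}G_{n+r}^{\,s}}{G_n^{\,j}}H_{m+(n+r)k-nj+(n-r)s}=(-1)^{(n+1)k}\left(\frac{G_r}{G_n}\right)^kH_m .$$ (iv) If $G_r\neq 0$, then $$\sum_{j=0}^k\sum_{s=0}^{k-j}(-1)^{ns+j+s}\binom kj\binom{k-j}s\frac{G_0^{\,j}G_{n+r}^{\,s}}{G_r^{\,j+s}}H_{m-(n+r)k+rj+ns}=(-1)^{(n+1)k}\left(\frac{G_n}{G_r}\right)^kH_m .$$ (v) If $G_r\neq 0$, then $$\sum_{j=0}^k\sum_{s=0}^{k-j}(-1)^{ns+j}\binom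 kj\binom{k-j}s\frac{G_0^{\,j}G_n^{\,s}}{G_r^{\,j+s}}H_{m-nk+rj+(n+r)s}=(-1)^{nk}\left(\frac{G_{n+r}}{G_r}\right)^kH_m .$$ (vi) If $G_r\neq 0$, then $$\sum_{j=0}^k\sum_{s=0}^{k-j}(-1)^{n(j+s)+j}\binom kj\binom{k-j}s\frac{G_{n+r}^{\,j}G_n^{\,s}}{G_r^{\,j+s}}H_{m-rk+nj+(n+r)s}=\left(\frac{G_0}{G_r}\right)^kH_m .$$
   Context: A generalized Fibonacci sequence $\{G_m\}$ is defined by $G_m=G_{m-1}+G_{m-2}$ for $m\ge 2$, with arbitrary (say complex) initial values $G_0,G_1$. The case $G_0=0$, $G_1=1$ is the Fibonacci sequence $\{F_m\}$. Extension to negative indices is by $G_{-m}=(-1)^m(F_{m+1}G_0-F_mG_1)$ for $m\ge 1$, so that $G_m=G_{m-1}+G_{m-2}$ holds for all integers $m$. $\{H_m\}$ denotes another generalized Fibonacci sequence, i.e. it satisfies the same recurrence and negative-index extension with its own arbitrary initial values $H_0,H_1$. Convention: $x^0=1$ for every $x$, including $x=0$. *)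

theory Defs
  imports Complex_Main "HOL-Number_Theory.Fib"
begin

text \<open>
  A generalized Fibonacci sequence, indexed by the integers. The initial values \<^term>\<open>G 0\<close> and
  \<^term>\<open>G 1\<close> are unconstrained; the second conjunct extends the sequence to negative indices, where
  \<^const>\<open>fib\<close> is the library's Fibonacci sequence with \<^prop>\<open>fib 0 = 0\<close> and \<^prop>\<open>fib 1 = 1\<close>.
\<close>
definition gen_fib :: "(int \<Rightarrow> complex) \<Rightarrow> bool" where
  "gen_fib G \<longleftrightarrow>
     (\<forall>m\<ge>2. G m = G (m - 1) + G (m - 2)) \<and>
     (\<forall>m::nat. m \<ge> 1 \<longrightarrow>
        G (- int m) = (-1) ^ m * (of_nat (fib (m + 1)) * G 0 - of_nat (fib m) * G 1))"

lemma gen_fib_rec: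
  assumes "gen_fib G"
  shows "G m = G (m - 1) + G (m - 2)"
proof -
  have neg: "G (- int i) = (-1) ^ i * (of_nat (fib (i + 1)) * G 0 - of_nat (fib i) * G 1)" for i
    using assms by (cases "i = 0") (auto simp: gen_fib_def)
  consider "m \<ge> 2" | "m = 1" | "m \<le> 0" by linarith
  then show ?thesis
  proof cases
    case 1
    then show ?thesis using assms by (simp add: gen_fib_def)
  next
    case 2
    then show ?thesis using neg[of 1] by simp
  next
    case 3
    define i where "i = nat (- m)"
    have m: "m = - int i" "m - 1 = - int (Suc i)" "m - 2 = - int (Suc (Suc i))"
      using 3 by (auto simp: i_def)
    show ?thesis unfolding m(2,3) unfolding m(1) neg by (simp add: algebra_simps)
  qed
qed

lemma gen_fib_exists: "\<exists>G. gen_fib G \<and> G 0 = a \<and> G 1 = b"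
proof -
  define G :: "int \<Rightarrow> complex" where "G = (\<lambda>m.
    if m = 0 then a
    else if m > 0 then of_nat (fib (nat m - 1)) * a + of_nat (fib (nat m)) * b
    else (-1) ^ nat (- m) * (of_nat (fib (nat (- m) + 1)) * a - of_nat (fib (nat (- m))) * b))"
  have "G m = G (m - 1) + G (m - 2)" if m: "m \<ge> 2" for m
  proof (cases "m = 2")
    case True
    then show ?thesis by (simp add: G_def numeral_2_eq_2)
  next
    case False
    define i where "i = nat (m - 3)"
    have "m = int i + 3" using False m by (simp add: i_def)
    then have "nat m = Suc (Suc (Suc i))" "nat (m - 1) = Suc (Suc i)" "nat (m - 2) = Suc i" "m > 2"
      by auto
    then show ?thesis by (simp add: G_def algebra_simps)
  qed
  moreover have "G 0 = a" "G 1 = b" by (simp_all add: G_def)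
  moreover have "\<forall>i::nat. i \<ge> 1 \<longrightarrow>
      G (- int i) = (-1) ^ i * (of_nat (fib (i + 1)) * a - of_nat (fib i) * b)"
    by (simp add: G_def)
  ultimately show ?thesis unfolding gen_fib_def by metis
qed

end

theory Submission
  imports Defs
begin

text \<open>
  All six identities are one linear relation, iterated \<open>k\<close> times. With \<open>\<sigma> = (-1)\<^sup>n\<close>,
  \[ G_0 H_{m+r} + \sigma G_{n+r} H_{m+n} - \sigma G_n H_{m+n+r} = G_r H_m . \]
  For fixed \<open>m\<close> and \<open>n\<close> the difference of the two sides satisfies the Fibonacci recurrence in \<open>r\<close>, so only
  \<open>r = 0\<close> (trivial) and \<open>r = 1\<close> need checking; the latter is d'Ocagne's identity, an instance of the
  fact that a Casorati determinant of two solutions changes sign at each step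
  (\<open>gen_fib_three_term\<close>).

  Solve this relation for one of its four terms, move the index \<open>m\<close> so that this term becomes a
  multiple of \<open>H m\<close>, and divide by the coefficient assumed to be nonzero. The result has the form
  \<open>c * H m = a * H (m + p) + b * H (m + q) + d * H (m + t)\<close> for all \<open>m\<close>: that is, \<open>H\<close> is an
  eigenvector, with eigenvalue \<open>c\<close>, of a sum of three weighted shift operators. Since shifts commute,
  the \<open>k\<close>-th power of that operator expands by the binomial theorem, used twice
  (\<open>three_term_power\<close>). Grouping two of the three operators first gives the sums over \<open>s \<le> j\<close> of
  (i)--(iii); reversing the outer sum gives the sums over \<open>s \<le> k - j\<close> of (iv)--(vi).
\<close>

section \<open>The three-term relation\<close>

lemma fib_recurrence_zero:
  fixes f :: "int \<Rightarrow> 'a::ab_group_add"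
  assumes rec: "\<And>i. f (i + 2) = f (i + 1) + f i" and "f 0 = 0" "f 1 = 0"
  shows "f i = 0"
proof -
  \<comment> \<open>Two consecutive zeros propagate in both directions.\<close>
  have "f i = 0 \<and> f (i + 1) = 0"
  proof (induction i rule: int_induct[where k = 0])
    case base
    then show ?case using assms by simp
  next
    case (step1 i)
    then show ?case using rec[of i] by (simp add: add.assoc)
  next
    case (step2 i)
    then show ?case using rec[of "i - 1"] by (simp add: add.commute)
  qed
  then show ?thesis ..
qed

lemma gen_fib_add_2:
  assumes "gen_fib G"
  shows "G (i + 2) = G (i + 1) + G i"
  using gen_fib_rec[OF assms, of "i + 2"] by (simp add: add.commute)

text \<open>
  The Fibonacci companion matrix has determinant \<open>-1\<close>, so the determinant formed from \<open>G\<close> and a shift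
  of \<open>H\<close> alternates in sign. Two consecutive values of \<open>n\<close> give opposite determinants, and multiplying
  by the sign \<open>(-1)\<^sup>n\<close> makes the expression constant.
\<close>
lemma gen_fib_dOcagne:
  assumes G: "gen_fib G" and H: "gen_fib H"
  shows "(-1) powi n * (G (n + 1) * H (m + n) - G n * H (m + n + 1)) = G 1 * H m - G 0 * H (m + 1)"
proof -
  define W where "W i = (-1) powi i * (G (i + 1) * H (m + i) - G i * H (m + i + 1))" for i :: int
  have step: "W (i + 1) = W i" for i
    using gen_fib_add_2[OF G, of i] gen_fib_add_2[OF H, of "m + i"]
    by (simp add: W_def power_int_add add.assoc algebra_simps)
  have "W n = W 0"
  proof (induction n rule: int_induct[where k = 0])
    case (step2 i)
    then show ?case using step[of "i - 1"] by simp
  qed (simp_all add: step)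
  then show ?thesis by (simp add: W_def)
qed

lemma gen_fib_three_term:
  assumes G: "gen_fib G" and H: "gen_fib H"
  shows "G 0 * H (m + r) + (-1) powi n * G (n + r) * H (m + n) - (-1) powi n * G n * H (m + n + r)
         = G r * H m"
proof -
  define D where "D r = G 0 * H (m + r) + (-1) powi n * G (n + r) * H (m + n)
      - (-1) powi n * G n * H (m + n + r) - G r * H m" for r
  have "D r = 0"
  proof (rule fib_recurrence_zero)
    show "D (i + 2) = D (i + 1) + D i" for i
      using gen_fib_add_2[OF G, of i] gen_fib_add_2[OF G, of "n + i"]
        gen_fib_add_2[OF H, of "m + i"] gen_fib_add_2[OF H, of "m + n + i"]
      unfolding D_def by (simp only: add.assoc) (simp add: algebra_simps)
    show "D 0 = 0" by (simp add: D_def)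
    show "D 1 = 0"
      using gen_fib_dOcagne[OF G H, of n m] by (simp add: D_def algebra_simps)
  qed
  then show ?thesis by (simp add: D_def)
qed

section \<open>Powers of a sum of weighted shifts\<close>

text \<open>
  The binomial theorem for two commuting operators, stated without operators: think of \<open>X k i l\<close>
  as \<open>(A + B)\<^sup>k A\<^sup>i B\<^sup>l\<close> applied to a fixed vector. The hypothesis splits off one factor
  \<open>A + B\<close> and moves it past the rest, which is where commutativity enters; the coefficients then arise
  from Pascal's rule.
\<close>
lemma pascal_expansion:
  fixes X :: "nat \<Rightarrow> nat \<Rightarrow> nat \<Rightarrow> 'a::semiring_1"
  assumes step: "\<And>k i l. X (Suc k) i l = X k (Suc i) l + X k i (Suc l)"
  shows "X k i l = (\<Sum>j=0..k. of_nat (k choose j) * X 0 (i + (k - j)) (l + j))"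
proof (induction k arbitrary: i l)
  case 0
  then show ?case by simp
next
  case (Suc k)
  let ?Y = "\<lambda>j. X 0 (i + (Suc k - j)) (l + j)"
  have A: "X k (Suc i) l = (\<Sum>j=0..k. of_nat (k choose j) * ?Y j)"
    unfolding Suc by (intro sum.cong) (auto simp: Suc_diff_le)
  have B: "X k i (Suc l) = (\<Sum>j=0..k. of_nat (k choose j) * ?Y (Suc j))"
    unfolding Suc by (intro sum.cong) auto
  have "(\<Sum>j=0..Suc k. of_nat (Suc k choose j) * ?Y j)
      = ?Y 0 + (\<Sum>j=0..k. of_nat (Suc k choose Suc j) * ?Y (Suc j))"
    by (subst sum.atLeast0_atMost_Suc_shift) (simp del: binomial_Suc_Suc)
  also have "\<dots> = ?Y 0 + (\<Sum>j=0..k. of_nat (k choose Suc j) * ?Y (Suc j))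
      + (\<Sum>j=0..k. of_nat (k choose j) * ?Y (Suc j))"
    by (simp add: sum.distrib distrib_right add_ac)
  also have "?Y 0 + (\<Sum>j=0..k. of_nat (k choose Suc j) * ?Y (Suc j))
      = (\<Sum>j=0..Suc k. of_nat (k choose j) * ?Y j)"
    by (subst sum.atLeast0_atMost_Suc_shift) simp
  also have "\<dots> = (\<Sum>j=0..k. of_nat (k choose j) * ?Y j)"
    by (simp add: binomial_eq_0)
  finally show ?case using A B step by simp
qed

text \<open>
  Put \<open>S f m = b * f (m + q) + d * f (m + t)\<close>. The hypothesis says that \<open>H\<close> is an eigenvector of
  \<open>a\<close> times the shift by \<open>p\<close> plus \<open>S\<close>; as \<open>S\<close> commutes with shifts, so are all iterates \<open>S\<^sup>l H\<close>.
  One binomial expansion therefore separates the shift by \<open>p\<close> from \<open>S\<close>, and a second one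
  expands \<open>S\<^sup>j\<close>.
\<close>
lemma three_term_power:
  fixes H :: "int \<Rightarrow> 'a::comm_ring_1"
  assumes rel: "\<And>m. c * H m = a * H (m + p) + b * H (m + q) + d * H (m + t)"
  shows "(\<Sum>j=0..k. \<Sum>s=0..j. of_nat (k choose j) * of_nat (j choose s)
            * (a ^ (k - j) * b ^ (j - s) * d ^ s)
            * H (m + p * int (k - j) + q * int (j - s) + t * int s))
         = c ^ k * H m"
proof -
  define S :: "(int \<Rightarrow> 'a) \<Rightarrow> int \<Rightarrow> 'a" where "S f m = b * f (m + q) + d * f (m + t)" for f m
  define I where "I l = (S ^^ l) H" for l
  have I_0: "I 0 = H" by (simp add: I_def)
  have I_Suc: "I (Suc l) m = b * I l (m + q) + d * I l (m + t)" for l m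
    by (simp add: I_def S_def)
  have eigen: "c * I l m = a * I l (m + p) + I (Suc l) m" for l m
  proof (induction l arbitrary: m)
    case 0
    then show ?case using rel[of m] by (simp add: I_Suc I_0 add.assoc)
  next
    case (Suc l)
    have "c * I (Suc l) m = b * (c * I l (m + q)) + d * (c * I l (m + t))"
      by (simp add: I_Suc algebra_simps)
    also have "\<dots> = a * (b * I l (m + p + q) + d * I l (m + p + t))
        + (b * I (Suc l) (m + q) + d * I (Suc l) (m + t))"
      unfolding Suc by (simp add: algebra_simps)
    finally show ?case by (simp only: I_Suc)
  qed
  have inner: "I j m = (\<Sum>s=0..j. of_nat (j choose s)
      * (b ^ (j - s) * d ^ s * H (m + q * int (j - s) + t * int s)))" for j m
    using pascal_expansion[of "\<lambda>k i l. b ^ i * d ^ l * I k (m + q * int i + t * int l)" j 0 0]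
    by (simp add: I_Suc I_0 algebra_simps)
  have "c ^ k * H m = (\<Sum>j=0..k. of_nat (k choose j)
      * (a ^ (k - j) * I j (m + p * int (k - j))))"
  proof -
    define X where "X k i l = c ^ k * (a ^ i * I l (m + p * int i))" for k i l
    have "X (Suc k) i l = X k (Suc i) l + X k i (Suc l)" for k i l
    proof -
      have "X (Suc k) i l = c ^ k * a ^ i * (c * I l (m + p * int i))"
        by (simp add: X_def mult_ac)
      then show ?thesis by (simp add: eigen X_def algebra_simps)
    qed
    from pascal_expansion[of X k 0 0, OF this] show ?thesis by (simp add: X_def I_0)
  qed
  then show ?thesis by (simp add: inner sum_distrib_left mult_ac)
qed

text \<open>
  Reversing the outer sum turns \<open>k - j\<close> factors into \<open>j\<close> factors, so the summand that keeps the
  complementary exponent is now the second one.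
\<close>
lemma three_term_power_rev:
  fixes H :: "int \<Rightarrow> 'a::comm_ring_1"
  assumes rel: "\<And>m. c * H m = a * H (m + p) + b * H (m + q) + d * H (m + t)"
  shows "(\<Sum>j=0..k. \<Sum>s=0..k - j. of_nat (k choose j) * of_nat ((k - j) choose s)
            * (a ^ j * b ^ (k - j - s) * d ^ s)
            * H (m + p * int j + q * int (k - j - s) + t * int s))
         = c ^ k * H m"
  unfolding three_term_power[of c H a p b q d t k m, OF rel, symmetric]
  by (rule sum.reindex_bij_witness[of _ "\<lambda>j. k - j" "\<lambda>j. k - j"])
    (auto simp: binomial_symmetric[symmetric])

section \<open>The six identities\<close>

text \<open>
  The two index sets parametrised by their complementary exponents, so that powers and indices
  contain no truncated subtraction.
\<close>
lemma sum_triangle_cong: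
  assumes "\<And>u s v. k = v + (u + s) \<Longrightarrow> f (u + s) s = g (u + s) s"
  shows "(\<Sum>j=0..k. \<Sum>s=0..j. f j s) = (\<Sum>j=0..k. \<Sum>s=0..(j::nat). g j s)"
proof (intro sum.cong refl)
  fix j s assume "j \<in> {0..k}" "s \<in> {0..j}"
  then show "f j s = g j s"
    using assms[of "k - j" "j - s" s] by simp
qed

lemma sum_co_triangle_cong:
  assumes "\<And>j u s. k = j + (u + s) \<Longrightarrow> f j s = g j s"
  shows "(\<Sum>j=0..k. \<Sum>s=0..k - j. f j s) = (\<Sum>j=0..k. \<Sum>s=0..k - (j::nat). g j s)"
proof (intro sum.cong refl)
  fix j s assume "j \<in> {0..k}" "s \<in> {0..k - j}"
  then show "f j s = g j s"
    using assms[of j "k - j - s" s] by simp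
qed

theorem theorem4:
  fixes G H :: "int \<Rightarrow> complex" and n m r :: int and k :: nat
  assumes "gen_fib G" and "gen_fib H"
  shows
    "(G 0 \<noteq> 0 \<longrightarrow>
       (\<Sum>j=0..k. \<Sum>s=0..j.
          (-1) powi (n * int j + int s) * of_nat (k choose j) * of_nat (j choose s)
          * (G (n + r) ^ (j - s) * G n ^ s / G 0 ^ j)
          * H (m + r * int k + (n - r) * int j + r * int s))
       = (G r / G 0) ^ k * H m) \<and>
     (G (n + r) \<noteq> 0 \<longrightarrow>
       (\<Sum>j=0..k. \<Sum>s=0..j.
          (-1) powi (n * (int j + int s) + int s) * of_nat (k choose j) * of_nat (j choose s)
          * (G 0 ^ (j - s) * G n ^ s / G (n + r) ^ j)
          * H (m + n * int k + (r - n) * int j + n * int s))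
       = (-1) powi (n * int k) * (G r / G (n + r)) ^ k * H m) \<and>
     (G n \<noteq> 0 \<longrightarrow>
       (\<Sum>j=0..k. \<Sum>s=0..j.
          (-1) powi (n * (int j + int s) + int j) * of_nat (k choose j) * of_nat (j choose s)
          * (G 0 ^ (j - s) * G (n + r) ^ s / G n ^ j)
          * H (m + (n + r) * int k - n * int j + (n - r) * int s))
       = (-1) powi ((n + 1) * int k) * (G r / G n) ^ k * H m) \<and>
     (G r \<noteq> 0 \<longrightarrow>
       (\<Sum>j=0..k. \<Sum>s=0..k - j.
          (-1) powi (n * int s + int j + int s) * of_nat (k choose j) * of_nat ((k - j) choose s)
          * (G 0 ^ j * G (n + r) ^ s / G r ^ (j + s))
          * H (m - (n + r) * int k + r * int j + n * int s))
       = (-1) powi ((n + 1) * int k) * (G n / G r) ^ k * H m) \<and>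
     (G r \<noteq> 0 \<longrightarrow>
       (\<Sum>j=0..k. \<Sum>s=0..k - j.
          (-1) powi (n * int s + int j) * of_nat (k choose j) * of_nat ((k - j) choose s)
          * (G 0 ^ j * G n ^ s / G r ^ (j + s))
          * H (m - n * int k + r * int j + (n + r) * int s))
       = (-1) powi (n * int k) * (G (n + r) / G r) ^ k * H m) \<and>
     (G r \<noteq> 0 \<longrightarrow>
       (\<Sum>j=0..k. \<Sum>s=0..k - j.
          (-1) powi (n * (int j + int s) + int j) * of_nat (k choose j) * of_nat ((k - j) choose s)
          * (G (n + r) ^ j * G n ^ s / G r ^ (j + s))
          * H (m - r * int k + n * int j + (n + r) * int s))
       = (G 0 / G r) ^ k * H m)"
proof -
  define \<sigma> :: complex where "\<sigma> = (-1) powi n"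
  have \<sigma>2: "\<sigma> * \<sigma> = 1"
    unfolding \<sigma>_def by (simp flip: power_int_add)
  have rel: "G 0 * H (i + r) + \<sigma> * G (n + r) * H (i + n) - \<sigma> * G n * H (i + n + r) = G r * H i" for i
    unfolding \<sigma>_def by (rule gen_fib_three_term[OF assms])
  have cancel: "\<sigma> * (\<sigma> * x) = x" for x
    using \<sigma>2 by (simp flip: mult.assoc)
  \<comment> \<open>Naming the sign \<open>-1\<close> keeps its powers separate from those of \<open>\<sigma>\<close> and of \<open>G\<close>. In the
    coefficients below each factor \<open>\<sigma>\<close> or \<open>e\<close> accounts for one part of the exponent of \<open>-1\<close>,
    which is why some products \<open>\<sigma> * \<sigma> = 1\<close> are written out.\<close>
  define e :: complex where "e = -1"
  have signs: "(-1) powi (n * int i) = \<sigma> ^ i" "(-1) powi int i = e ^ i" "(-1) ^ i = e ^ i" for i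
    by (simp_all add: \<sigma>_def e_def power_int_mult)
  have expand: "(-1 :: complex) powi (x + y) = (-1) powi x * (-1) powi y" for x y
    by (simp add: power_int_add)
  have \<sigma>_power2: "\<sigma> ^ i * \<sigma> ^ i = 1" for i
    by (simp add: \<sigma>2 flip: power_mult_distrib)
  note normalize = \<sigma>_power2 expand signs distrib_left distrib_right
    power_mult_distrib power_divide power_add
  show ?thesis
  proof (intro conjI impI, goal_cases)
    case 1
    have step: "G r / G 0 * H i = 1 * H (i + r) + (\<sigma> * G (n + r) / G 0) * H (i + n)
        + (e * \<sigma> * G n / G 0) * H (i + (n + r))" for i
      using rel[of i] 1 by (simp add: field_simps e_def cancel)
    show ?case
      unfolding three_term_power[of "G r / G 0" H, OF step, of k m, symmetric]
      by (rule sum_triangle_cong) (simp add: normalize left_diff_distrib algebra_simps)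
  next
    case 2
    have step: "\<sigma> * G r / G (n + r) * H i = 1 * H (i + n) + (\<sigma> * G 0 / G (n + r)) * H (i + r)
        + (e * \<sigma> * \<sigma> * G n / G (n + r)) * H (i + (n + r))" for i
      using arg_cong[OF rel[of i], of "(*) \<sigma>"] 2 by (simp add: field_simps e_def cancel)
    have rhs: "(-1) powi (n * int k) * (G r / G (n + r)) ^ k * H m
        = (\<sigma> * G r / G (n + r)) ^ k * H m"
      by (simp add: normalize)
    show ?case
      unfolding rhs three_term_power[of "\<sigma> * G r / G (n + r)" H, OF step, of k m, symmetric]
      by (rule sum_triangle_cong) (simp add: normalize left_diff_distrib algebra_simps)
  next
    case 3
    have step: "e * \<sigma> * G r / G n * H i = 1 * H (i + (n + r)) + (e * \<sigma> * G 0 / G n) * H (i + r)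
        + (e * \<sigma> * \<sigma> * G (n + r) / G n) * H (i + n)" for i
      using arg_cong[OF rel[of i], of "(*) \<sigma>"] 3
      by (simp add: field_simps e_def cancel) algebra
    have rhs: "(-1) powi ((n + 1) * int k) * (G r / G n) ^ k * H m
        = (e * \<sigma> * G r / G n) ^ k * H m"
      by (simp add: normalize)
    show ?case
      unfolding rhs three_term_power[of "e * \<sigma> * G r / G n" H, OF step, of k m, symmetric]
      by (rule sum_triangle_cong) (simp add: normalize left_diff_distrib algebra_simps)
  next
    case 4
    have step: "e * \<sigma> * G n / G r * H i = (e * G 0 / G r) * H (i + (- n)) + 1 * H (i + (- (n + r)))
        + (e * \<sigma> * G (n + r) / G r) * H (i + (- r))" for i
      using rel[of "i - (n + r)"] 4 by (simp add: field_simps e_def cancel) algebra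
    have rhs: "(-1) powi ((n + 1) * int k) * (G n / G r) ^ k * H m
        = (e * \<sigma> * G n / G r) ^ k * H m"
      by (simp add: normalize)
    show ?case
      unfolding rhs three_term_power_rev[of "e * \<sigma> * G n / G r" H, OF step, of k m, symmetric]
      by (rule sum_co_triangle_cong) (simp add: normalize left_diff_distrib algebra_simps)
  next
    case 5
    have step: "\<sigma> * G (n + r) / G r * H i = (e * G 0 / G r) * H (i + (r - n)) + 1 * H (i + (- n))
        + (\<sigma> * G n / G r) * H (i + r)" for i
      using rel[of "i - n"] 5 by (simp add: field_simps e_def cancel)
    have rhs: "(-1) powi (n * int k) * (G (n + r) / G r) ^ k * H m
        = (\<sigma> * G (n + r) / G r) ^ k * H m"
      by (simp add: normalize)
    show ?case
      unfolding rhs three_term_power_rev[of "\<sigma> * G (n + r) / G r" H, OF step, of k m, symmetric]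
      by (rule sum_co_triangle_cong) (simp add: normalize left_diff_distrib algebra_simps)
  next
    case 6
    have step: "G 0 / G r * H i = (e * \<sigma> * G (n + r) / G r) * H (i + (n - r)) + 1 * H (i + (- r))
        + (\<sigma> * G n / G r) * H (i + n)" for i
      using rel[of "i - r"] 6 by (simp add: field_simps e_def cancel)
    show ?case
      unfolding three_term_power_rev[of "G 0 / G r" H, OF step, of k m, symmetric]
      by (rule sum_co_triangle_cong) (simp add: normalize left_diff_distrib algebra_simps)
  qed
qed

end
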